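(* Assume $U^{(o)}\ne0$ and define the corrected compatibility operator $\widetilde C_H^{\mathrm{EC}}:=\widetilde C_H-\widetilde L_H$, with $\widetilde C_H$, $\widetilde L_H$ and $U^{(o)}$ as in the context. Then $$(U^{(o)})^\top\,\widetilde C_H^{\mathrm{EC}}\,U^{(o)}=0 .$$
   Context: Physical setting. Repeated spatial indices $k$ are summed. The system is $\partial_tu+A_k(u)\partial_{x_k}u=0$, $u\in\mathbb R^m$ with values in an admissible set $\mathcal U$, $A_k=\partial_uF_k$. A smooth energy pair $(e,g_k)$ satisfies $\nabla_ue^\top A_k=\nabla_ug_k^\top$. On $\mathcal U$, $e>0$ and $\mathcal H_e=\nabla_u^2e$ is symmetric positive definite (SPD); $H(u)=\frac{2e(u)}{u^\top\mathcal H_e(u)u}\mathcal H_e(u)$, with eigenvalues in a fixed interval $[c_H,C_H]\subset(0,\infty)$. $G_k$ is a smooth symmetric matrix field with $g_k=\tfrac12u^\top G_ku$, and $G_k=H(A_k+\Delta A_k)$ defines $\Delta A_k$. Discrete setting. $\Omega\subset\mathbb R^d$ is an element with outward unit normal $n$, $V^p$ the polynomials of degree $\le p$, $N_p=\dim V^p$, $\{\phi_\alpha\}$ an $L^2$-orthonormal basis of $V^p$, $\Phi_\alpha=\phi_\alpha I_m$, $\Phi=[\Phi_1\cdots\Phi_{N_p}]$, and $u_p=\Phi U$ with $U(t)\in\mathbb R^{mN_p}$. $Q_{3p}$, $Q_{3p+1}^{\partial\Omega}$, $Q_{\mathrm{hi}(n)}$ ($n\ge3p+1$) are positive-weight quadratures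 (volume, face, volume) of exactness degrees $3p$, $3p+1$, $n$. For $X\in\{A,\Delta A\}$, $Y_{X,k,p+1}\in(V^{p+1})^{m\times m}$ is the componentwise discrete $L^2$ projection of $H(u_p)X_k(u_p)$ onto $V^{p+1}$ with quadrature $Q_{\mathrm{hi}(n)}$. Set $(\widetilde M_H)_{\alpha\beta}=Q_{3p}[\Phi_\alpha^\top H(u_p)\Phi_\beta]$ (SPD), $(\widetilde V_H)_{\alpha\beta}=Q_{3p}[\Phi_\alpha^\top(\partial_{x_k}Y_{A,k,p+1})\Phi_\beta]$, $(\widetilde B_{H,\Delta})_{\alpha\beta}=Q^{\partial\Omega}_{3p+1}[\Phi_\alpha^\top Y_{\Delta A,k,p+1}\Phi_\beta n_k]$, and $\dot{\widetilde M}_H=Q_{3p}[\Phi^\top D_{u}H(u_p)[\partial_tu_p]\Phi]$. Orthogonalization. $\widetilde M_H=\widetilde R^\top\widetilde R$ with $\widetilde R$ upper triangular Cholesky; $U^{(o)}:=\widetilde RU$, $\widetilde X^{(o)}:=\widetilde R^{-\top}\widetilde X\widetilde R^{-1}$, in particular $\dot{\widetilde M}_H^{(o)}=\widetilde R^{-\top}\dot{\widetilde M}_H\widetilde R^{-1}$. Compatibility operator and residual: $\widetilde C_H:=\tfrac12\big(\dot{\widetilde M}_H^{(o)}+\widetilde V_H^{(o)}+\widetilde B_{H,\Delta}^{(o)}\big)$, $\rho_H:=(U^{(o)})^\top\widetilde C_HU^{(o)}$, $\widetilde L_H:=\dfrac{\rho_H}{\|U^{(o)}\|^4}U^{(o)}(U^{(o)})^\top$.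 *)

theory Defs
  imports "HOL-Analysis.Analysis"
begin

text \<open>With \<open>real^'k\<close> the type parser forces the sort \<open>finite\<close> on \<open>'k\<close>, which clashes with a
  declared sort \<open>{finite,linorder}\<close>; these synonyms leave the sort open.\<close>

type_synonym 'k rvec = "(real, 'k) vec"
type_synonym 'k rmat = "((real, 'k) vec, 'k) vec"


section \<open>Smooth maps, gradients, matrices\<close>

fun Ck_on :: "nat \<Rightarrow> ('a::real_normed_vector \<Rightarrow> 'b::real_normed_vector) \<Rightarrow> 'a set \<Rightarrow> bool" where
  "Ck_on 0 f W \<longleftrightarrow> continuous_on W f"
| "Ck_on (Suc k) f W \<longleftrightarrow>
     (\<forall>x\<in>W. f differentiable (at x)) \<and>
     (\<forall>v. Ck_on k (\<lambda>x. frechet_derivative f (at x) v) W)"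

text \<open>The set need not be open; as usual, smoothness is that of a function
  given on an open neighbourhood.\<close>

definition smooth_on :: "'a::real_normed_vector set \<Rightarrow> ('a \<Rightarrow> 'b::real_normed_vector) \<Rightarrow> bool" where
  "smooth_on S f \<longleftrightarrow> (\<exists>W. open W \<and> S \<subseteq> W \<and> (\<forall>k. Ck_on k f W))"

definition grad :: "(real^'m \<Rightarrow> real) \<Rightarrow> real^'m \<Rightarrow> real^'m" where
  "grad f u = (\<chi> i. frechet_derivative f (at u) (axis i 1))"

definition hess :: "(real^'m \<Rightarrow> real) \<Rightarrow> real^'m \<Rightarrow> real^'m^'m" where
  "hess f u = jacobian (grad f) (at u)"

definition symmetric_matrix :: "real^'k^'k \<Rightarrow> bool" where
  "symmetric_matrix M \<longleftrightarrow> transpose M = M"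

definition spd :: "real^'k^'k \<Rightarrow> bool" where
  "spd M \<longleftrightarrow> symmetric_matrix M \<and> (\<forall>v. v \<noteq> 0 \<longrightarrow> 0 < v \<bullet> (M *v v))"

definition eigenvalues_in :: "real^'k^'k \<Rightarrow> real set \<Rightarrow> bool" where
  "eigenvalues_in M I \<longleftrightarrow> (\<forall>l v. v \<noteq> 0 \<and> M *v v = l *\<^sub>R v \<longrightarrow> l \<in> I)"


section \<open>Energy structure\<close>

text \<open>At \<open>u = 0\<close> the quotient is not defined mathematically; here it is \<open>0\<close>,
  so a positive lower bound on the eigenvalues over the admissible set excludes \<open>0\<close> from that set.\<close>

definition energy_H :: "(real^'m \<Rightarrow> real) \<Rightarrow> real^'m \<Rightarrow> real^'m^'m" where
  "energy_H e u = (2 * e u / (u \<bullet> (hess e u *v u))) *\<^sub>R hess e u"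

definition energy_pair ::
  "(real^'m) set \<Rightarrow> ('d \<Rightarrow> real^'m \<Rightarrow> real^'m^'m) \<Rightarrow> (real^'m \<Rightarrow> real) \<Rightarrow> ('d \<Rightarrow> real^'m \<Rightarrow> real) \<Rightarrow> bool" where
  "energy_pair \<U> A e g \<longleftrightarrow>
     smooth_on \<U> e \<and> (\<forall>k. smooth_on \<U> (g k)) \<and>
     (\<forall>u\<in>\<U>. \<forall>k. grad e u v* A k u = grad (g k) u)"


section \<open>Surface measure and elements\<close>

definition hausdorff_pre :: "nat \<Rightarrow> real \<Rightarrow> 'a::metric_space set \<Rightarrow> ennreal" where
  "hausdorff_pre s \<delta> S =
     (INF C \<in> {C :: nat \<Rightarrow> 'a set. S \<subseteq> (\<Union>i. C i) \<and> (\<forall>i. bounded (C i) \<and> diameter (C i) \<le> \<delta>)}.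
        \<Sum>i. if C i = {} then 0 else ennreal (unit_ball_vol (real s) * (diameter (C i) / 2) ^ s))"

definition hausdorff_outer :: "nat \<Rightarrow> 'a::metric_space set \<Rightarrow> ennreal" where
  "hausdorff_outer s S = (SUP \<delta>\<in>{0<..}. hausdorff_pre s \<delta> S)"

text \<open>Normalized so that in dimension \<open>d\<close> the case \<open>s = d - 1\<close> is the
  usual surface measure; for \<open>s = 0\<close> it is the counting measure.\<close>

definition hausdorff :: "nat \<Rightarrow> 'a::metric_space measure" where
  "hausdorff s = measure_of UNIV (sets borel) (hausdorff_outer s)"

text \<open>The following facts lead to \<open>emeasure_hausdorff\<close>: the outer measure is countably additive
  on Borel sets, so \<open>measure_of\<close> does not collapse to the zero measure.\<close>

lemma hausdorff_pre_empty: assumes "\<delta> > 0" shows "hausdorff_pre s \<delta> {} = 0"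
proof -
  have "hausdorff_pre s \<delta> ({}::'a set) \<le> (\<Sum>i::nat. if ({}::'a set) = {} then 0 else ennreal (unit_ball_vol (real s) * (diameter ({}::'a set) / 2) ^ s))"
    unfolding hausdorff_pre_def
    by (rule INF_lower2[where i="\<lambda>_. {}"]) (use assms in auto)
  then show ?thesis by simp
qed

lemma hausdorff_pre_mono: "S \<subseteq> S' \<Longrightarrow> hausdorff_pre s \<delta> S \<le> hausdorff_pre s \<delta> S'"
  unfolding hausdorff_pre_def by (rule INF_superset_mono) auto

lemma hausdorff_pre_antimono: "\<delta> \<le> \<delta>' \<Longrightarrow> hausdorff_pre s \<delta>' S \<le> hausdorff_pre s \<delta> S"
  unfolding hausdorff_pre_def by (rule INF_superset_mono) (auto intro: order_trans)

lemma hausdorff_pre_subadd: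
  "hausdorff_pre s \<delta> (\<Union>i. A i) \<le> (\<Sum>i. hausdorff_pre s \<delta> (A i :: 'a::metric_space set))"
proof (rule ennreal_le_epsilon)
  fix r :: real
  assume fin: "(\<Sum>i. hausdorff_pre s \<delta> (A i)) < top" and r: "0 < r"
  let ?w = "\<lambda>c::'a set. if c = {} then 0 else ennreal (unit_ball_vol (real s) * (diameter c / 2) ^ s)"
  have ex: "\<exists>C. (A i \<subseteq> (\<Union>j. C j) \<and> (\<forall>j. bounded (C j) \<and> diameter (C j) \<le> \<delta>)) \<and>
      (\<Sum>j. ?w (C j)) \<le> hausdorff_pre s \<delta> (A i) + ennreal (r * (1/2) ^ Suc i)" for i
  proof -
    have lt: "hausdorff_pre s \<delta> (A i) < top"
      using ennreal_suminf_lessD[OF fin] by simp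
    have "0 < ennreal (r * (1/2) ^ Suc i)" using r by simp
    then have "hausdorff_pre s \<delta> (A i) + 0 < hausdorff_pre s \<delta> (A i) + ennreal (r * (1/2) ^ Suc i)"
      unfolding ennreal_add_left_cancel_less using lt by (simp only: infinity_ennreal_def less_top simp_thms)
    then have "hausdorff_pre s \<delta> (A i) < hausdorff_pre s \<delta> (A i) + ennreal (r * (1/2) ^ Suc i)"
      by (simp only: add_0_right)
    then have "\<exists>C\<in>{C. A i \<subseteq> (\<Union>j. C j) \<and> (\<forall>j. bounded (C j) \<and> diameter (C j) \<le> \<delta>)}.
        (\<Sum>j. ?w (C j)) < hausdorff_pre s \<delta> (A i) + ennreal (r * (1/2) ^ Suc i)"
      unfolding hausdorff_pre_def[of s \<delta> "A i"]
      apply (subst (asm) INF_less_iff) apply assumption done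
    then show ?thesis by (blast intro: less_imp_le)
  qed
  define P where "P i C \<longleftrightarrow> A i \<subseteq> (\<Union>j. C j) \<and> (\<forall>j. bounded (C j) \<and> diameter (C j) \<le> \<delta>) \<and>
      (\<Sum>j. ?w (C j)) \<le> hausdorff_pre s \<delta> (A i) + ennreal (r * (1/2) ^ Suc i)" for i and C :: "nat \<Rightarrow> 'a set"
  have "\<exists>C. P i C" for i using ex[of i] unfolding P_def by (elim exE conjE) (intro exI conjI; assumption)
  then obtain C where PC: "\<And>i. P i (C i)" by metis
  have C: "\<And>i. A i \<subseteq> (\<Union>j. C i j)" "\<And>i j. bounded (C i j)" "\<And>i j. diameter (C i j) \<le> \<delta>"
     "\<And>i. (\<Sum>j. ?w (C i j)) \<le> hausdorff_pre s \<delta> (A i) + ennreal (r * (1/2) ^ Suc i)"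
    using PC[unfolded P_def] by (elim conjE allE; assumption | blast)+
  define D where "D = case_prod C \<circ> prod_decode"
  have "(\<Union>i. A i) \<subseteq> (\<Union>k. D k)"
  proof
    fix x assume "x \<in> (\<Union>i. A i)"
    then obtain i j where "x \<in> C i j" using C(1) by blast
    then have "x \<in> D (prod_encode (i,j))" by (simp add: D_def)
    then show "x \<in> (\<Union>k. D k)" by blast
  qed
  then have "hausdorff_pre s \<delta> (\<Union>i. A i) \<le> (\<Sum>k. ?w (D k))"
    unfolding hausdorff_pre_def
    by (intro INF_lower) (auto simp: D_def C split: prod.split)
  also have "\<dots> = (\<Sum>k. (\<lambda>(i,j). ?w (C i j)) (prod_decode k))"
    by (rule suminf_cong) (simp add: D_def split: prod.split)
  also have "\<dots> = (\<Sum>i j. ?w (C i j))"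
    by (subst suminf_ennreal_2dimen[where f="case_prod (\<lambda>i j. ?w (C i j))"]) (auto simp: comp_def)
  also have "\<dots> \<le> (\<Sum>i. hausdorff_pre s \<delta> (A i) + ennreal (r * (1/2) ^ Suc i))"
    by (intro suminf_le C(4)) auto
  also have "\<dots> = (\<Sum>i. hausdorff_pre s \<delta> (A i)) + (\<Sum>i. ennreal (r * (1/2) ^ Suc i))"
    by (rule suminf_add[symmetric]) auto
  also have "(\<Sum>i. ennreal (r * (1/2) ^ Suc i)) = ennreal r"
  proof -
    have "(\<lambda>i. r * (1/2) ^ Suc i) sums (r * 1)"
      by (intro sums_mult power_half_series)
    then show ?thesis using r by (intro suminf_ennreal_eq) auto
  qed
  finally show "hausdorff_pre s \<delta> (\<Union>i. A i) \<le> (\<Sum>i. hausdorff_pre s \<delta> (A i)) + ennreal r" .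
qed

lemma hausdorff_outer_empty: "hausdorff_outer s {} = 0"
proof -
  have "hausdorff_outer s {} \<le> 0"
    unfolding hausdorff_outer_def by (rule SUP_least) (simp add: hausdorff_pre_empty)
  then show ?thesis by simp
qed

lemma hausdorff_outer_mono: "S \<subseteq> S' \<Longrightarrow> hausdorff_outer s S \<le> hausdorff_outer s S'"
  unfolding hausdorff_outer_def by (rule SUP_mono) (auto intro: hausdorff_pre_mono)

lemma hausdorff_outer_subadd:
  "hausdorff_outer s (\<Union>i. A i) \<le> (\<Sum>i. hausdorff_outer s (A i))"
  unfolding hausdorff_outer_def[of s "\<Union>i. A i"]
proof (rule SUP_least)
  fix \<delta> :: real assume "\<delta> \<in> {0<..}"
  then show "hausdorff_pre s \<delta> (\<Union>i. A i) \<le> (\<Sum>i. hausdorff_outer s (A i))"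
    by (intro order_trans[OF hausdorff_pre_subadd] suminf_le) (auto simp: hausdorff_outer_def intro: SUP_upper)
qed

lemma hausdorff_outer_space: "outer_measure_space UNIV (hausdorff_outer s :: 'a::metric_space set \<Rightarrow> ennreal)"
  unfolding outer_measure_space_def positive_def increasing_def countably_subadditive_def
  by (auto simp: hausdorff_outer_empty hausdorff_outer_subadd intro: hausdorff_outer_mono)

lemma hausdorff_outer_Un: "hausdorff_outer s (S \<union> S') \<le> hausdorff_outer s S + hausdorff_outer s S'"
proof -
  have "hausdorff_outer s (\<Union>i. binaryset S S' i) \<le> (\<Sum>i. hausdorff_outer s (binaryset S S' i))"
    by (rule hausdorff_outer_subadd)
  then show ?thesis by (simp add: UN_binaryset_eq suminf_binaryset_eq hausdorff_outer_empty)
qed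

lemma hausdorff_outer_separated:
  assumes "0 < r" and far: "\<And>x y. x \<in> S \<Longrightarrow> y \<in> S' \<Longrightarrow> r \<le> dist x y"
  shows "hausdorff_outer s S + hausdorff_outer s S' \<le> hausdorff_outer s (S \<union> (S'::'a::metric_space set))"
proof -
  let ?w = "\<lambda>c::'a set. if c = {} then 0 else ennreal (unit_ball_vol (real s) * (diameter c / 2) ^ s)"
  have *: "hausdorff_pre s \<delta> S + hausdorff_pre s \<delta> S' \<le> hausdorff_outer s (S \<union> S')" if \<delta>: "0 < \<delta>" "\<delta> < r" for \<delta>
  proof -
    have "hausdorff_pre s \<delta> S + hausdorff_pre s \<delta> S' \<le> hausdorff_pre s \<delta> (S \<union> S')"
      unfolding hausdorff_pre_def[of s \<delta> "S \<union> S'"]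
    proof (rule INF_greatest, clarify)
      fix C :: "nat \<Rightarrow> 'a set"
      assume C: "S \<union> S' \<subseteq> (\<Union>i. C i)" "\<forall>i. bounded (C i) \<and> diameter (C i) \<le> \<delta>"
      define C1 where "C1 i = (if C i \<inter> S = {} then {} else C i)" for i
      define C2 where "C2 i = (if C i \<inter> S = {} then C i else {})" for i
      have disj: "C i \<inter> S' = {}" if "C i \<inter> S \<noteq> {}" for i
      proof (rule ccontr)
        assume "C i \<inter> S' \<noteq> {}"
        with that obtain x y where xy: "x \<in> C i" "x \<in> S" "y \<in> C i" "y \<in> S'" by blast
        then have "dist x y \<le> diameter (C i)" using C(2) by (intro diameter_bounded_bound) auto
        with C(2) \<delta> far[OF xy(2,4)] show False by (metis leD order_trans)
      qed
      have "hausdorff_pre s \<delta> S \<le> (\<Sum>i. ?w (C1 i))"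
        unfolding hausdorff_pre_def by (intro INF_lower) (use C \<delta> in \<open>auto simp: C1_def, blast+\<close>)
      moreover have "hausdorff_pre s \<delta> S' \<le> (\<Sum>i. ?w (C2 i))"
        unfolding hausdorff_pre_def
      proof (intro INF_lower, clarsimp, intro conjI)
        show "S' \<subseteq> (\<Union>i. C2 i)"
        proof
          fix x assume x: "x \<in> S'"
          with C(1) obtain i where "x \<in> C i" by blast
          with x disj[of i] show "x \<in> (\<Union>i. C2 i)" by (auto simp: C2_def)
        qed
        show "\<forall>i. bounded (C2 i) \<and> diameter (C2 i) \<le> \<delta>" using C(2) \<delta> by (auto simp: C2_def)
      qed
      ultimately have "hausdorff_pre s \<delta> S + hausdorff_pre s \<delta> S' \<le> (\<Sum>i. ?w (C1 i)) + (\<Sum>i. ?w (C2 i))"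
        by (rule add_mono)
      also have "\<dots> = (\<Sum>i. ?w (C1 i) + ?w (C2 i))" by (rule suminf_add) auto
      also have "\<dots> = (\<Sum>i. ?w (C i))" by (rule suminf_cong) (auto simp: C1_def C2_def)
      finally show "hausdorff_pre s \<delta> S + hausdorff_pre s \<delta> S' \<le> (\<Sum>i. ?w (C i))" .
    qed
    also have "\<dots> \<le> hausdorff_outer s (S \<union> S')"
      unfolding hausdorff_outer_def by (rule SUP_upper) (use \<delta> in auto)
    finally show ?thesis .
  qed
  have "hausdorff_outer s S + hausdorff_outer s S'
      = (SUP \<delta>\<in>{0<..}. hausdorff_pre s \<delta> S + hausdorff_pre s \<delta> S')"
    unfolding hausdorff_outer_def
  proof (rule SUP_add_directed_ennreal[symmetric])
    fix i j :: real assume "i \<in> {0<..}" "j \<in> {0<..}"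
    then show "\<exists>k\<in>{0<..}. hausdorff_pre s i S + hausdorff_pre s j S' \<le> hausdorff_pre s k S + hausdorff_pre s k S'"
      by (intro bexI[of _ "min i j"]) (auto intro!: add_mono hausdorff_pre_antimono)
  qed
  also have "\<dots> \<le> hausdorff_outer s (S \<union> S')"
  proof (rule SUP_least)
    fix \<delta> :: real assume d: "\<delta> \<in> {0<..}"
    then have "hausdorff_pre s \<delta> S + hausdorff_pre s \<delta> S' \<le> hausdorff_pre s (min \<delta> (r/2)) S + hausdorff_pre s (min \<delta> (r/2)) S'"
      by (intro add_mono hausdorff_pre_antimono) auto
    also have "\<dots> \<le> hausdorff_outer s (S \<union> S')" by (rule *) (use d assms in auto)
    finally show "hausdorff_pre s \<delta> S + hausdorff_pre s \<delta> S' \<le> hausdorff_outer s (S \<union> S')" .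
  qed
  finally show ?thesis .
qed

lemma hausdorff_outer_separated_sum:
  fixes B :: "nat \<Rightarrow> 'a::metric_space set"
  assumes "\<And>i j. i < j \<Longrightarrow> \<exists>r>0. \<forall>k\<ge>j. \<forall>x\<in>B i. \<forall>y\<in>B k. r \<le> dist x y"
  shows "(\<Sum>i<n. hausdorff_outer s (B i)) \<le> hausdorff_outer s (\<Union>i<n. B i)"
proof (induction n)
  case (Suc n)
  have "\<exists>r>0. \<forall>x\<in>(\<Union>i<n. B i). \<forall>y\<in>B n. r \<le> dist x y"
  proof -
    have "\<forall>i\<in>{..<n}. \<exists>r>0. \<forall>x\<in>B i. \<forall>y\<in>B n. r \<le> dist x y"
      using assms by (metis lessThan_iff order_refl)
    then obtain r where r: "\<And>i. i < n \<Longrightarrow> 0 < r i" "\<And>i x y. i < n \<Longrightarrow> x \<in> B i \<Longrightarrow> y \<in> B n \<Longrightarrow> r i \<le> dist x y"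
      by (auto simp: bchoice_iff)
    show ?thesis
      by (rule exI[of _ "Min (insert 1 (r ` {..<n}))"]) (use r in \<open>auto simp: Min_gr_iff intro: order_trans[OF Min_le]\<close>)
  qed
  then obtain r where r: "r > 0" "\<And>x y. x \<in> (\<Union>i<n. B i) \<Longrightarrow> y \<in> B n \<Longrightarrow> r \<le> dist x y" by blast
  have "(\<Sum>i<Suc n. hausdorff_outer s (B i)) \<le> hausdorff_outer s (\<Union>i<n. B i) + hausdorff_outer s (B n)"
    using Suc by (simp add: add_right_mono)
  also have "\<dots> \<le> hausdorff_outer s ((\<Union>i<n. B i) \<union> B n)"
    by (rule hausdorff_outer_separated[OF r])
  also have "(\<Union>i<n. B i) \<union> B n = (\<Union>i<Suc n. B i)" by (auto simp: less_Suc_eq)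
  finally show ?case .
qed simp

lemma hausdorff_outer_closed:
  fixes F :: "'a::metric_space set"
  assumes F: "closed F"
  shows "hausdorff_outer s (X \<inter> F) + hausdorff_outer s (X - F) \<le> hausdorff_outer s X"
proof (cases "F = {} \<or> hausdorff_outer s X = top")
  case True
  then show ?thesis by (auto simp: hausdorff_outer_empty)
next
  case False
  then have Fne: "F \<noteq> {}" and fin: "hausdorff_outer s X < top" by (auto simp: less_top)
  let ?H = "hausdorff_outer s :: 'a set \<Rightarrow> ennreal"
  define a where "a n = {x\<in>X. 1 / real (Suc n) \<le> infdist x F}" for n
  define b where "b n = {x\<in>X. 1 / real (Suc (Suc n)) \<le> infdist x F \<and> infdist x F < 1 / real (Suc n)}" for n
  have sep: "\<exists>r>0. \<forall>k\<ge>j. \<forall>x\<in>b (i). \<forall>y\<in>b k. r \<le> dist x y" if "Suc i < j" for i j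
  proof (intro exI[of _ "1 / real (Suc (Suc i)) - 1 / real (Suc j)"] conjI allI impI ballI)
    have "1 / real (Suc j) < 1 / real (Suc (Suc i))" by (rule frac_less2) (use that in auto)
    then show "0 < 1 / real (Suc (Suc i)) - 1 / real (Suc j)" by simp
    fix k x y assume k: "j \<le> k" and x: "x \<in> b i" and y: "y \<in> b k"
    have "infdist y F < 1 / real (Suc k)" using y by (simp add: b_def)
    also have "\<dots> \<le> 1 / real (Suc j)" by (rule frac_le) (use k in auto)
    finally show "1 / real (Suc (Suc i)) - 1 / real (Suc j) \<le> dist x y"
      using x infdist_triangle[of x F y] by (simp add: b_def)
  qed
  have part: "(\<Sum>i<n. ?H (b (2*i + c))) \<le> ?H X" for n c
  proof -
    have "(\<Sum>i<n. ?H (b (2*i + c))) \<le> ?H (\<Union>i<n. b (2*i+c))"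
    proof (rule hausdorff_outer_separated_sum)
      fix i j :: nat assume "i < j"
      then have "Suc (2*i+c) < 2*j+c" by simp
      from sep[OF this] obtain r where r: "r > 0" "\<forall>k\<ge>2*j+c. \<forall>x\<in>b (2*i+c). \<forall>y\<in>b k. r \<le> dist x y"
        by blast
      have "\<forall>k\<ge>j. \<forall>x\<in>b (2*i+c). \<forall>y\<in>b (2*k+c). r \<le> dist x y"
      proof (intro allI impI)
        fix k assume "j \<le> k"
        then have "2*j+c \<le> 2*k+c" by simp
        with r(2) show "\<forall>x\<in>b (2*i+c). \<forall>y\<in>b (2*k+c). r \<le> dist x y" by blast
      qed
      with r(1) show "\<exists>r>0. \<forall>k\<ge>j. \<forall>x\<in>b (2*i+c). \<forall>y\<in>b (2*k+c). r \<le> dist x y" by blast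
    qed
    also have "\<dots> \<le> ?H X" by (rule hausdorff_outer_mono) (auto simp: b_def)
    finally show ?thesis .
  qed
  have bd: "(\<Sum>i<n. ?H (b i)) \<le> 2 * ?H X" for n
  proof -
    have "(\<Sum>i<n. ?H (b i)) \<le> (\<Sum>i<2*n. ?H (b i))" by (rule sum_mono2) auto
    also have "\<dots> = (\<Sum>i<n. ?H (b (2*i + 0))) + (\<Sum>i<n. ?H (b (2*i + 1)))"
      by (induction n) (simp_all add: algebra_simps)
    also have "\<dots> \<le> ?H X + ?H X" by (intro add_mono part)
    finally show ?thesis by (simp add: mult_2)
  qed
  have sfin: "(\<Sum>i. ?H (b i)) < top"
  proof -
    have "(\<Sum>i. ?H (b i)) \<le> 2 * ?H X" by (intro suminf_le_const bd) auto
    also have "\<dots> < top" using fin by (simp add: ennreal_mult_less_top)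
    finally show ?thesis .
  qed
  have cover: "X - F \<subseteq> a n \<union> (\<Union>i. b (i + n))" for n
  proof
    fix x assume x: "x \<in> X - F"
    then have pos: "0 < infdist x F" using F Fne
      by (metis DiffD2 in_closed_iff_infdist_zero infdist_nonneg order_le_less)
    show "x \<in> a n \<union> (\<Union>i. b (i + n))"
    proof (cases "1 / real (Suc n) \<le> infdist x F")
      case True then show ?thesis using x by (auto simp: a_def)
    next
      case False
      let ?P = "\<lambda>m. 1 / real (Suc m) \<le> infdist x F"
      obtain m0 where "?P m0" using reals_Archimedean[OF pos] by (auto simp: inverse_eq_divide intro: less_imp_le)
      define m where "m = (LEAST m. ?P m)"
      have m: "?P m" unfolding m_def by (rule LeastI[of ?P, OF \<open>?P m0\<close>])
      have mn: "n < m"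
      proof (rule ccontr)
        assume "\<not> n < m"
        then have "1 / real (Suc n) \<le> 1 / real (Suc m)" by (intro frac_le) auto
        with m False show False by simp
      qed
      then obtain l where l: "m = Suc l" by (cases m) auto
      have "\<not> ?P l" using l unfolding m_def by (metis lessI not_less_Least)
      then have "x \<in> b l" using m l x by (auto simp: b_def)
      moreover have "l = (l - n) + n" using mn l by simp
      ultimately have "x \<in> (\<Union>i. b (i + n))" by (metis UNIV_I UN_I)
      then show ?thesis ..
    qed
  qed
  have step: "?H (X \<inter> F) + ?H (X - F) \<le> ?H X + (\<Sum>i. ?H (b (i + n)))" for n
  proof -
    have "?H (X - F) \<le> ?H (a n \<union> (\<Union>i. b (i + n)))" by (rule hausdorff_outer_mono[OF cover])
    also have "\<dots> \<le> ?H (a n) + ?H (\<Union>i. b (i + n))" by (rule hausdorff_outer_Un)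
    also have "\<dots> \<le> ?H (a n) + (\<Sum>i. ?H (b (i + n)))" by (intro add_left_mono hausdorff_outer_subadd)
    finally have "?H (X \<inter> F) + ?H (X - F) \<le> (?H (X \<inter> F) + ?H (a n)) + (\<Sum>i. ?H (b (i + n)))"
      by (simp add: add.assoc add_left_mono)
    also have "?H (X \<inter> F) + ?H (a n) \<le> ?H ((X \<inter> F) \<union> a n)"
    proof (rule hausdorff_outer_separated[of "1 / real (Suc n)"])
      fix x y assume "x \<in> X \<inter> F" "y \<in> a n"
      then show "1 / real (Suc n) \<le> dist x y"
        using infdist_le[of x F y] by (auto simp: a_def dist_commute)
    qed simp
    also have "\<dots> \<le> ?H X" by (rule hausdorff_outer_mono) (auto simp: a_def)
    finally show ?thesis by (simp add: add_right_mono)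
  qed
  define r where "r i = enn2real (?H (b i))" for i
  have bf: "?H (b i) = ennreal (r i)" for i
    using ennreal_suminf_lessD[OF sfin, of i] by (simp add: r_def)
  have rn: "0 \<le> r i" for i by (simp add: r_def)
  have sm: "summable r"
  proof (rule summable_suminf_not_top)
    show "(\<Sum>i. ennreal (r i)) \<noteq> top" using sfin unfolding bf by (simp only: less_top not_False_eq_True)
  qed (simp add: r_def)
  show ?thesis
  proof (rule ennreal_le_epsilon)
    fix \<epsilon> :: real assume "0 < \<epsilon>"
    from suminf_exist_split[OF this sm] obtain n where n: "norm (\<Sum>i. r (i + n)) < \<epsilon>" by auto
    have "(\<Sum>i. ?H (b (i + n))) = ennreal (\<Sum>i. r (i + n))"
      unfolding bf by (rule suminf_ennreal2) (use sm in \<open>simp_all add: summable_iff_shift rn\<close>)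
    also have "\<dots> \<le> ennreal \<epsilon>" using n by (intro ennreal_leI) auto
    finally show "?H (X \<inter> F) + ?H (X - F) \<le> ?H X + ennreal \<epsilon>"
      using step[of n] by (meson add_left_mono order_trans)
  qed
qed

lemma sets_hausdorff [simp]: "sets (hausdorff s) = sets borel"
  unfolding hausdorff_def by (simp add: sets.sigma_sets_eq[of borel, simplified])

lemma emeasure_hausdorff:
  fixes B :: "'a::metric_space set"
  assumes "B \<in> sets borel"
  shows "emeasure (hausdorff s) B = hausdorff_outer s B"
proof -
  let ?L = "lambda_system UNIV UNIV (hausdorff_outer s :: 'a set \<Rightarrow> ennreal)"
  have ms: "measure_space UNIV ?L (hausdorff_outer s)"
    using sigma_algebra.caratheodory_lemma[OF sigma_algebra_Pow, of UNIV "hausdorff_outer s :: 'a set \<Rightarrow> ennreal"] hausdorff_outer_space[of s] by simp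
  then interpret L: sigma_algebra UNIV ?L by (simp add: measure_space_def)
  have "closed F \<Longrightarrow> F \<in> ?L" for F
  proof -
    assume F: "closed F"
    have "hausdorff_outer s (X \<inter> F) + hausdorff_outer s (X - F) = hausdorff_outer s X" for X :: "'a set"
    proof (rule antisym)
      show "hausdorff_outer s X \<le> hausdorff_outer s (X \<inter> F) + hausdorff_outer s (X - F)"
        using hausdorff_outer_Un[of s "X \<inter> F" "X - F"] by (simp add: Int_Diff_Un)
    qed (rule hausdorff_outer_closed[OF F])
    then show "F \<in> ?L"
      by (subst algebra.lambda_system_eq) (auto simp: algebra_Pow[of UNIV, simplified])
  qed
  then have sub: "sets borel \<subseteq> ?L"
    unfolding borel_eq_closed by (simp, intro L.sigma_sets_subset) auto
  have pos: "positive (sets borel) (hausdorff_outer s :: 'a set \<Rightarrow> ennreal)"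
    by (simp add: positive_def hausdorff_outer_empty)
  have add: "countably_additive (sets borel) (hausdorff_outer s :: 'a set \<Rightarrow> ennreal)"
    unfolding countably_additive_def
  proof (intro allI impI)
    fix A :: "nat \<Rightarrow> 'a set"
    assume "range A \<subseteq> sets borel" "disjoint_family A"
    moreover from this sub have "range A \<subseteq> ?L" by blast
    moreover have "countably_additive ?L (hausdorff_outer s)" using ms by (simp add: measure_space_def)
    ultimately show "(\<Sum>i. hausdorff_outer s (A i)) = hausdorff_outer s (\<Union> (range A))"
      using L.countable_UN[of A UNIV] by (simp add: countably_additive_def)
  qed
  show ?thesis
    unfolding hausdorff_def
    by (rule emeasure_measure_of_sigma[OF _ pos add assms]) (use sets.sigma_algebra_axioms[of borel] in simp)
qed

text \<open>Near \<open>x\<close> the set \<open>\<Omega>\<close> looks like the half-space \<open>{y. (y - x) \<bullet> \<nu> < 0}\<close>.\<close>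

definition outward_normal_at :: "(real^'d) set \<Rightarrow> real^'d \<Rightarrow> real^'d \<Rightarrow> bool" where
  "outward_normal_at \<Omega> x \<nu> \<longleftrightarrow> norm \<nu> = 1 \<and>
     (\<forall>\<epsilon>>0. \<exists>r>0. \<forall>y. norm (y - x) < r \<longrightarrow>
        ((y - x) \<bullet> \<nu> < - \<epsilon> * norm (y - x) \<longrightarrow> y \<in> \<Omega>) \<and>
        ((y - x) \<bullet> \<nu> > \<epsilon> * norm (y - x) \<longrightarrow> y \<notin> closure \<Omega>))"

text \<open>The normal is given face by face, because a point on several faces (an edge or a corner)
  carries one normal for each of them. At such a point it is the limit of the normals at
  regular points of the same face.\<close>

definition element ::
  "(real^'d) set \<Rightarrow> (real^'d) set set \<Rightarrow> ((real^'d) set \<Rightarrow> real^'d \<Rightarrow> real^'d) \<Rightarrow> bool" where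
  "element \<Omega> faces n \<longleftrightarrow>
     open \<Omega> \<and> bounded \<Omega> \<and> \<Omega> \<noteq> {} \<and>
     finite faces \<and> \<Union>faces = frontier \<Omega> \<and>
     (\<forall>\<sigma>\<in>faces. compact \<sigma> \<and> emeasure (hausdorff (CARD('d) - 1)) \<sigma> < \<infinity> \<and>
        continuous_on \<sigma> (n \<sigma>) \<and> \<sigma> \<subseteq> closure {x\<in>\<sigma>. outward_normal_at \<Omega> x (n \<sigma> x)}) \<and>
     (\<forall>\<sigma>\<in>faces. \<forall>\<tau>\<in>faces. \<sigma> \<noteq> \<tau> \<longrightarrow> emeasure (hausdorff (CARD('d) - 1)) (\<sigma> \<inter> \<tau>) = 0)"


section \<open>Polynomials, quadrature, projection\<close>

text \<open>Polynomials of total degree at most \<open>p\<close>.\<close>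

definition poly_space :: "nat \<Rightarrow> (real^'d \<Rightarrow> real) set" where
  "poly_space p = {q. \<exists>c :: ('d \<Rightarrow> nat) \<Rightarrow> real.
     q = (\<lambda>x. \<Sum>a | (\<Sum>k\<in>UNIV. a k) \<le> p. c a * (\<Prod>k\<in>UNIV. (x $ k) ^ a k))}"

definition orthonormal_basis :: "(real^'d) set \<Rightarrow> nat \<Rightarrow> ('n::finite \<Rightarrow> real^'d \<Rightarrow> real) \<Rightarrow> bool" where
  "orthonormal_basis \<Omega> p \<phi> \<longleftrightarrow>
     (\<forall>\<alpha>. \<phi> \<alpha> \<in> poly_space p) \<and>
     (\<forall>q\<in>poly_space p. \<exists>c. q = (\<lambda>x. \<Sum>\<alpha>\<in>UNIV. c \<alpha> * \<phi> \<alpha> x)) \<and>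
     (\<forall>\<alpha> \<beta>. (LINT x:\<Omega>|lborel. \<phi> \<alpha> x * \<phi> \<beta> x) = (if \<alpha> = \<beta> then 1 else 0))"

text \<open>A quadrature consists of its nodes and its weights.\<close>

type_synonym 'd quadrature = "(real^'d) set \<times> (real^'d \<Rightarrow> real)"

definition quad :: "'d::finite quadrature \<Rightarrow> (real^'d \<Rightarrow> 'b::real_vector) \<Rightarrow> 'b" where
  "quad Q f = (\<Sum>x\<in>fst Q. snd Q x *\<^sub>R f x)"

definition exact_quadrature ::
  "(real^'d) measure \<Rightarrow> (real^'d) set \<Rightarrow> nat \<Rightarrow> 'd::finite quadrature \<Rightarrow> bool" where
  "exact_quadrature \<mu> S r Q \<longleftrightarrow>
     finite (fst Q) \<and> fst Q \<subseteq> closure S \<and> (\<forall>x\<in>fst Q. 0 < snd Q x) \<and>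
     (\<forall>q\<in>poly_space r. quad Q q = (LINT x:S|\<mu>. q x))"

text \<open>\<open>Y\<close> is the componentwise projection of \<open>f\<close> onto the polynomials of degree at most \<open>r\<close>,
  with respect to the \<open>L\<^sup>2\<close> product discretized by \<open>Q\<close>.\<close>

definition discrete_projection ::
  "'d::finite quadrature \<Rightarrow> nat \<Rightarrow> (real^'d \<Rightarrow> real^'m^'m) \<Rightarrow> (real^'d \<Rightarrow> real^'m^'m) \<Rightarrow> bool" where
  "discrete_projection Q r f Y \<longleftrightarrow> (\<forall>i j.
     (\<lambda>x. Y x $ i $ j) \<in> poly_space r \<and>
     (\<forall>v\<in>poly_space r. quad Q (\<lambda>x. Y x $ i $ j * v x) = quad Q (\<lambda>x. f x $ i $ j * v x)))"


section \<open>Discrete operators\<close>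

text \<open>The pair \<open>(\<alpha>, i)\<close> indexes component \<open>i\<close> of block \<open>\<alpha>\<close>, so that \<open>Phi \<phi> x\<close> is the
  row of blocks \<open>\<phi> \<alpha> x\<close> times the identity.\<close>

definition Phi :: "('n::finite \<Rightarrow> real^'d \<Rightarrow> real) \<Rightarrow> real^'d \<Rightarrow> real^('n \<times> 'm)^'m" where
  "Phi \<phi> x = (\<chi> i. \<chi> s. if snd s = i then \<phi> (fst s) x else 0)"

definition gram ::
  "'d quadrature \<Rightarrow> ('n::finite \<Rightarrow> real^'d \<Rightarrow> real) \<Rightarrow> (real^'d \<Rightarrow> real^'m^'m) \<Rightarrow> real^('n \<times> 'm)^('n \<times> 'm)" where
  "gram Q \<phi> W = quad Q (\<lambda>x. transpose (Phi \<phi> x) ** W x ** Phi \<phi> x)"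

definition mass_H ::
  "(real^'m \<Rightarrow> real) \<Rightarrow> 'd quadrature \<Rightarrow> ('n::finite \<Rightarrow> real^'d \<Rightarrow> real) \<Rightarrow> (real^'d \<Rightarrow> real^'m) \<Rightarrow>
     real^('n \<times> 'm)^('n \<times> 'm)" where
  "mass_H e Q \<phi> u = gram Q \<phi> (\<lambda>x. energy_H e (u x))"

definition mass_H_dot ::
  "(real^'m \<Rightarrow> real) \<Rightarrow> 'd quadrature \<Rightarrow> ('n::finite \<Rightarrow> real^'d \<Rightarrow> real) \<Rightarrow> (real^'d \<Rightarrow> real^'m) \<Rightarrow>
     (real^'d \<Rightarrow> real^'m) \<Rightarrow> real^('n \<times> 'm)^('n \<times> 'm)" where
  "mass_H_dot e Q \<phi> u du = gram Q \<phi> (\<lambda>x. frechet_derivative (energy_H e) (at (u x)) (du x))"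

definition volume_H ::
  "'d quadrature \<Rightarrow> ('n::finite \<Rightarrow> real^'d \<Rightarrow> real) \<Rightarrow> ('d \<Rightarrow> real^'d \<Rightarrow> real^'m^'m) \<Rightarrow>
     real^('n \<times> 'm)^('n \<times> 'm)" where
  "volume_H Q \<phi> Y = gram Q \<phi> (\<lambda>x. \<Sum>k\<in>UNIV. frechet_derivative (Y k) (at x) (axis k 1))"

definition boundary_H ::
  "(real^'d) set set \<Rightarrow> ((real^'d) set \<Rightarrow> 'd quadrature) \<Rightarrow> ((real^'d) set \<Rightarrow> real^'d \<Rightarrow> real^'d) \<Rightarrow>
     ('n::finite \<Rightarrow> real^'d \<Rightarrow> real) \<Rightarrow> ('d \<Rightarrow> real^'d \<Rightarrow> real^'m^'m) \<Rightarrow> real^('n \<times> 'm)^('n \<times> 'm)" where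
  "boundary_H faces Q n \<phi> Y =
     (\<Sum>\<sigma>\<in>faces. gram (Q \<sigma>) \<phi> (\<lambda>x. \<Sum>k\<in>UNIV. (n \<sigma> x $ k) *\<^sub>R Y k x))"

text \<open>Rows and columns are ordered by block first, then by component within the block.\<close>

definition upper_triangular_block :: "real^('n::{finite,linorder} \<times> 'm::{finite,linorder})^('n \<times> 'm) \<Rightarrow> bool" where
  "upper_triangular_block R \<longleftrightarrow>
     (\<forall>\<alpha> i \<beta> j. \<beta> < \<alpha> \<or> \<beta> = \<alpha> \<and> j < i \<longrightarrow> R $ (\<alpha>, i) $ (\<beta>, j) = 0)"

definition cholesky ::
  "real^('n::{finite,linorder} \<times> 'm::{finite,linorder})^('n \<times> 'm) \<Rightarrow> real^('n \<times> 'm)^('n \<times> 'm) \<Rightarrow> bool" where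
  "cholesky M R \<longleftrightarrow> upper_triangular_block R \<and> (\<forall>r. 0 < R $ r $ r) \<and> M = transpose R ** R"

definition orthogonalize :: "real^'k^'k \<Rightarrow> real^'k^'k \<Rightarrow> real^'k^'k" where
  "orthogonalize R X = transpose (matrix_inv R) ** X ** matrix_inv R"

definition compat_op :: "real^'k^'k \<Rightarrow> real^'k^'k \<Rightarrow> real^'k^'k \<Rightarrow> real^'k^'k \<Rightarrow> real^'k^'k" where
  "compat_op R Mdot V B =
     (1/2) *\<^sub>R (orthogonalize R Mdot + orthogonalize R V + orthogonalize R B)"

definition residual :: "real^'k^'k \<Rightarrow> real^'k \<Rightarrow> real" where
  "residual C u = u \<bullet> (C *v u)"

definition correction_op :: "real^'k^'k \<Rightarrow> real^'k \<Rightarrow> real^'k^'k" where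
  "correction_op C u = (residual C u / norm u ^ 4) *\<^sub>R ((columnvector u :: real^1^'k) ** rowvector u)"

definition corrected_op :: "real^'k^'k \<Rightarrow> real^'k \<Rightarrow> real^'k^'k" where
  "corrected_op C u = C - correction_op C u"

end

theory Submission
  imports Defs
begin

text \<open>The quadratic form of the rank-one matrix \<open>u u\<^sup>T\<close> takes the value
  \<open>(u \<bullet> u)\<^sup>2 = \<parallel>u\<parallel>\<^sup>4\<close> at \<open>u\<close>. The factor \<open>1 / \<parallel>u\<parallel>\<^sup>4\<close> in the correction
  therefore makes the correction reproduce the residual of \<open>C\<close> at \<open>u\<close>, and subtracting it cancels
  this residual.\<close>

lemma outer_product_mult_vec:
  fixes u v w :: "real^'k"
  shows "((columnvector u :: real^1^'k) ** rowvector v) *v w = (v \<bullet> w) *\<^sub>R u"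
  by (simp add: vec_eq_iff matrix_vector_mult_def matrix_matrix_mult_def columnvector_def
      rowvector_def inner_vec_def sum_distrib_left sum_distrib_right mult_ac)

lemma residual_correction_op:
  assumes "u \<noteq> 0"
  shows "u \<bullet> (correction_op C u *v u) = residual C u"
proof -
  have "norm u ^ 4 = (u \<bullet> u) * (u \<bullet> u)"
    by (simp add: dot_square_norm power2_eq_square power4_eq_xxxx mult.assoc)
  moreover have "u \<bullet> u \<noteq> 0"
    using assms by simp
  ultimately show ?thesis
    by (simp add: correction_op_def outer_product_mult_vec scaleR_matrix_vector_assoc[symmetric])
qed

lemma corrected_op_quadratic_form_zero:
  assumes "u \<noteq> 0"
  shows "u \<bullet> (corrected_op C u *v u) = 0"
  by (simp add: corrected_op_def matrix_vector_mult_diff_rdistrib inner_diff_right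
      residual_correction_op[OF assms] residual_def)

theorem proposition6p4:
  fixes \<U> :: "('m::{finite,linorder} rvec) set"
    and F :: "'d::finite \<Rightarrow> 'm rvec \<Rightarrow> 'm rvec"
    and A \<Delta>A G :: "'d \<Rightarrow> 'm rvec \<Rightarrow> 'm rmat"
    and e :: "'m rvec \<Rightarrow> real"
    and g :: "'d \<Rightarrow> 'm rvec \<Rightarrow> real"
    and c\<^sub>H C\<^sub>H :: real
    and \<Omega> :: "(real^'d) set"
    and faces :: "(real^'d) set set"
    and n :: "(real^'d) set \<Rightarrow> real^'d \<Rightarrow> real^'d"
    and p n\<^sub>h\<^sub>i :: nat
    and \<phi> :: "'n::{finite,linorder} \<Rightarrow> real^'d \<Rightarrow> real"
    and Q Q\<^sub>h\<^sub>i :: "'d quadrature"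
    and Q\<^sub>f :: "(real^'d) set \<Rightarrow> 'd quadrature"
    and T :: "real set"
    and t :: real
    and U :: "real \<Rightarrow> ('n \<times> 'm) rvec"
    and u :: "real \<Rightarrow> real^'d \<Rightarrow> 'm rvec"
    and du :: "real^'d \<Rightarrow> 'm rvec"
    and Y\<^sub>A Y\<^sub>\<Delta> :: "'d \<Rightarrow> real^'d \<Rightarrow> 'm rmat"
    and R C\<^sub>t C\<^sub>E\<^sub>C :: "('n \<times> 'm) rmat"
    and U\<^sub>o :: "('n \<times> 'm) rvec"
  assumes flux: "\<And>k v. v \<in> \<U> \<Longrightarrow> (F k has_derivative (\<lambda>w. A k v *v w)) (at v)"
    and pair: "energy_pair \<U> A e g"
    and e_pos: "\<And>v. v \<in> \<U> \<Longrightarrow> 0 < e v"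
    and hess_spd: "\<And>v. v \<in> \<U> \<Longrightarrow> spd (hess e v)"
    and bounds: "0 < c\<^sub>H" "c\<^sub>H \<le> C\<^sub>H"
    and H_eigen: "\<And>v. v \<in> \<U> \<Longrightarrow> eigenvalues_in (energy_H e v) {c\<^sub>H..C\<^sub>H}"
    and G_smooth: "\<And>k. smooth_on \<U> (G k)"
    and G_sym: "\<And>k v. v \<in> \<U> \<Longrightarrow> symmetric_matrix (G k v)"
    and G_flux: "\<And>k v. v \<in> \<U> \<Longrightarrow> g k v = (1/2) * (v \<bullet> (G k v *v v))"
    and \<Delta>A: "\<And>k v. v \<in> \<U> \<Longrightarrow> G k v = energy_H e v ** (A k v + \<Delta>A k v)"
    and element: "element \<Omega> faces n"
    and basis: "orthonormal_basis \<Omega> p \<phi>"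
    and Q: "exact_quadrature lborel \<Omega> (3 * p) Q"
    and Q_face: "\<And>\<sigma>. \<sigma> \<in> faces \<Longrightarrow>
          exact_quadrature (hausdorff (CARD('d) - 1)) \<sigma> (3 * p + 1) (Q\<^sub>f \<sigma>)"
    and n_hi: "3 * p + 1 \<le> n\<^sub>h\<^sub>i"
    and Q_hi: "exact_quadrature lborel \<Omega> n\<^sub>h\<^sub>i Q\<^sub>h\<^sub>i"
    and time: "is_interval T" "interior T \<noteq> {}" "t \<in> T"
    and U_diff: "U differentiable_on T"
    and u: "u = (\<lambda>s x. Phi \<phi> x *v U s)"
    and u_admissible: "\<And>x. x \<in> fst Q \<union> fst Q\<^sub>h\<^sub>i \<Longrightarrow> u t x \<in> \<U>"
    and du: "du = (\<lambda>x. vector_derivative (\<lambda>s. u s x) (at t within T))"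
    and Y_A: "\<And>k. discrete_projection Q\<^sub>h\<^sub>i (p + 1) (\<lambda>x. energy_H e (u t x) ** A k (u t x)) (Y\<^sub>A k)"
    and Y_\<Delta>: "\<And>k. discrete_projection Q\<^sub>h\<^sub>i (p + 1) (\<lambda>x. energy_H e (u t x) ** \<Delta>A k (u t x)) (Y\<^sub>\<Delta> k)"
    and R: "cholesky (mass_H e Q \<phi> (u t)) R"
    and U\<^sub>o: "U\<^sub>o = R *v U t"
    and C\<^sub>t: "C\<^sub>t = compat_op R (mass_H_dot e Q \<phi> (u t) du) (volume_H Q \<phi> Y\<^sub>A)
                  (boundary_H faces Q\<^sub>f n \<phi> Y\<^sub>\<Delta>)"
    and C\<^sub>E\<^sub>C: "C\<^sub>E\<^sub>C = corrected_op C\<^sub>t U\<^sub>o"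
    and nonzero: "U\<^sub>o \<noteq> 0"
  shows "U\<^sub>o \<bullet> (C\<^sub>E\<^sub>C *v U\<^sub>o) = 0"
  unfolding C\<^sub>E\<^sub>C using nonzero by (rule corrected_op_quadratic_form_zero)

end
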